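(* If $G$ is a graph containing a cycle, with girth $g(G)$, then $L_1(G)\geq \left\lfloor\frac{g(G)}{3}\right\rfloor$. Moreover, the lower bound is tight, i.e. there exist graphs for which equality holds.
   Context: All graphs are finite, undirected, simple and nontrivial (at least two vertices). The girth $g(G)$ is the length of a shortest cycle in $G$. $N[v]=\{v\}\cup N(v)$ is the closed neighbourhood of $v$. A set $B\subseteq V(G)$ is a $1$-limited packing if $|N[v]\cap B|\le 1$ for every vertex $v$ of $G$; $L_1(G)$ is the maximum cardinality of a $1$-limited packing in $G$. *)

theory Defs
  imports "Graph_Theory.Graph_Theory"
begin

text \<open>
  An undirected simple graph is a \<open>pair_graph\<close>: a finite, loop-free, symmetric digraph whose
  arcs are ordered pairs, each undirected edge \<open>uv\<close> being the two arcs \<open>(u, v)\<close> and \<open>(v, u)\<close>.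
\<close>

definition nontrivial_graph :: "'a pair_pre_digraph \<Rightarrow> bool" where
  "nontrivial_graph G \<longleftrightarrow> pair_graph G \<and> 2 \<le> card (pverts G)"

text \<open>
  In a symmetric digraph the library's \<open>cycle\<close> also admits the closed walk \<open>u, v, u\<close> along a
  single edge. The length bound excludes exactly these.
\<close>

definition graph_cycle :: "'a pair_pre_digraph \<Rightarrow> ('a \<times> 'a) awalk \<Rightarrow> bool" where
  "graph_cycle G p \<longleftrightarrow> pre_digraph.cycle (with_proj G) p \<and> 3 \<le> length p"

text \<open>Only meaningful if \<open>G\<close> contains a cycle.\<close>

definition girth :: "'a pair_pre_digraph \<Rightarrow> nat" where
  "girth G = (LEAST n. \<exists>p. graph_cycle G p \<and> length p = n)"

definition closed_nbhd :: "'a pair_pre_digraph \<Rightarrow> 'a \<Rightarrow> 'a set" where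
  "closed_nbhd G v = insert v {u. (v, u) \<in> parcs G}"

definition limited_packing :: "nat \<Rightarrow> 'a pair_pre_digraph \<Rightarrow> 'a set \<Rightarrow> bool" where
  "limited_packing k G B \<longleftrightarrow>
     B \<subseteq> pverts G \<and> (\<forall>v \<in> pverts G. card (closed_nbhd G v \<inter> B) \<le> k)"

definition limited_packing_number :: "nat \<Rightarrow> 'a pair_pre_digraph \<Rightarrow> nat" where
  "limited_packing_number k G = Max {card B | B. limited_packing k G B}"

end

theory Submission
  imports Defs
begin

text \<open>
  Every third vertex of a shortest cycle is taken. If some \<open>w\<close> had two of them in its closed
  neighbourhood, the segment of the cycle between these two would be closed up through \<open>w\<close>, or by a
  chord if \<open>w\<close> lies on the segment, to a cycle shorter than the girth. Equality holds for the
  triangle.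
\<close>

section \<open>Cycles as arc lists and as vertex lists\<close>

lemma pcas_vwalk_arcs: "q \<noteq> [] \<Longrightarrow> pcas (hd q) (vwalk_arcs q) (last q)"
  by (induction q rule: vwalk_arcs.induct) auto

lemma pawalk_verts_vwalk_arcs: "q \<noteq> [] \<Longrightarrow> pawalk_verts (hd q) (vwalk_arcs q) = q"
  by (induction q rule: vwalk_arcs.induct) auto

lemma vwalk_arcs_subset_iff: "set (vwalk_arcs q) \<subseteq> A \<longleftrightarrow> successively (\<lambda>u v. (u, v) \<in> A) q"
  by (induction q rule: vwalk_arcs.induct) auto

lemma length_vwalk_arcs: "length (vwalk_arcs q) = length q - 1"
  using vwalk_length_simp unfolding vwalk_length_def .

lemma pcas_imp_successively:
  "pcas u p v \<Longrightarrow> set p \<subseteq> A \<Longrightarrow> successively (\<lambda>u v. (u, v) \<in> A) (u # map snd p)"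
  by (induction p arbitrary: u) (auto simp: successively_Cons)

text \<open>Library cycles are lists of arcs, whereas shortcuts are easiest to describe as lists of
  distinct vertices. Repeating the head at the end turns such a list into a closed walk with as many
  arcs as the list has vertices.\<close>

lemma graph_cycle_vwalk_arcs:
  assumes "pair_graph G" "distinct xs" "3 \<le> length xs"
    and "successively (\<lambda>u v. (u, v) \<in> parcs G) xs" "(last xs, hd xs) \<in> parcs G"
  shows "graph_cycle G (vwalk_arcs (xs @ [hd xs]))"
proof -
  interpret pair_graph G by fact
  let ?q = "xs @ [hd xs]"
  have ne: "xs \<noteq> []"
    using assms(3) by auto
  have "successively (\<lambda>u v. (u, v) \<in> parcs G) ?q"
    using assms(4,5) by (simp add: successively_append_iff)
  then have "awalk (hd xs) (vwalk_arcs ?q) (hd xs)"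
    using pcas_vwalk_arcs[of ?q] ne in_arcsD2[OF assms(5)]
    by (simp add: awalk_def vwalk_arcs_subset_iff)
  moreover have "pawalk_verts (hd xs) (vwalk_arcs ?q) = ?q"
    using pawalk_verts_vwalk_arcs[of ?q] ne by simp
  moreover have "distinct (tl ?q)"
    using assms(2) ne by (cases xs) auto
  moreover have "length (vwalk_arcs ?q) = length xs"
    by (simp add: length_vwalk_arcs)
  ultimately show ?thesis
    unfolding graph_cycle_def cycle_def using assms(3) by auto
qed

text \<open>Minimality of the girth in the form used for contradictions: it suffices to exhibit a
  short list of vertices that closes up.\<close>

lemma girth_le_length:
  assumes "pair_graph G" "distinct xs" "3 \<le> length xs"
    and "successively (\<lambda>u v. (u, v) \<in> parcs G) xs" "(last xs, hd xs) \<in> parcs G"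
  shows "girth G \<le> length xs"
proof -
  have "length (vwalk_arcs (xs @ [hd xs])) = length xs"
    by (simp add: length_vwalk_arcs)
  then show ?thesis
    unfolding girth_def using graph_cycle_vwalk_arcs[OF assms] by (intro Least_le) blast
qed

lemma girth_attained:
  assumes "\<exists>p. graph_cycle G p"
  obtains p where "graph_cycle G p" "length p = girth G"
proof -
  have "\<exists>n p. graph_cycle G p \<and> length p = n"
    using assms by blast
  from LeastI_ex[OF this] show ?thesis
    unfolding girth_def[symmetric] using that by blast
qed

text \<open>A shortest cycle is cut open by taking the second components of its arcs. This drops the
  start vertex, which the closed walk visits again at its end, so no vertex is repeated or
  lost.\<close>

lemma girth_path:
  assumes "pair_graph G" "\<exists>p. graph_cycle G p"
  obtains xs where "distinct xs" "length xs = girth G" "set xs \<subseteq> pverts G"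
    "successively (\<lambda>u v. (u, v) \<in> parcs G) xs"
proof -
  interpret pair_graph G by fact
  obtain p where p: "graph_cycle G p" "length p = girth G"
    using assms(2) by (rule girth_attained)
  then obtain u where u: "awalk u p u" "distinct (tl (pawalk_verts u p))" "p \<noteq> []"
    unfolding graph_cycle_def cycle_def by auto
  then have cas: "pcas u p u" and arcs: "set p \<subseteq> parcs G"
    by (auto simp: awalk_def)
  show thesis
  proof
    show "distinct (map snd p)"
      using u awalk_verts_conv'[OF cas] by simp
    show "length (map snd p) = girth G"
      using p by simp
    show "set (map snd p) \<subseteq> pverts G"
      using arcs arc_snd_in_verts unfolding set_map by blast
    show "successively (\<lambda>u v. (u, v) \<in> parcs G) (map snd p)"
      using pcas_imp_successively[OF cas arcs] by (auto simp: successively_Cons)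
  qed
qed

section \<open>Shortcuts between vertices of a shortest cycle\<close>

lemma successively_take: "successively P xs \<Longrightarrow> successively P (take n xs)"
  by (metis append_take_drop_id successively_append_iff)

lemma successively_drop: "successively P xs \<Longrightarrow> successively P (drop n xs)"
  by (metis append_take_drop_id successively_append_iff)

text \<open>The list \<open>take (Suc (j - i)) (drop i xs)\<close> is the segment from index
  \<open>i\<close> to index \<open>j\<close>, both ends included, hence the
  \<open>Suc\<close>.\<close>

lemma last_take_drop:
  "i \<le> j \<Longrightarrow> j < length xs \<Longrightarrow> last (take (Suc (j - i)) (drop i xs)) = xs ! j"
  by (simp add: take_Suc_conv_app_nth)

text \<open>A chord would close the segment to a cycle on \<open>j - i + 1\<close> vertices, fewer
  than the girth. The gap of 2 gives this cycle three vertices; the last bound excludes the pair of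
  end points of the path, which the shortest cycle itself may join.\<close>

lemma girth_path_no_chord:
  assumes "pair_graph G" "distinct xs" "length xs = girth G"
    and "successively (\<lambda>u v. (u, v) \<in> parcs G) xs"
    and "i + 2 \<le> j" "j < length xs" "j - i + 1 < length xs"
  shows "(xs ! j, xs ! i) \<notin> parcs G"
proof
  assume chord: "(xs ! j, xs ! i) \<in> parcs G"
  define ys where "ys = take (Suc (j - i)) (drop i xs)"
  have "hd ys = xs ! i" "last ys = xs ! j" "length ys = j - i + 1"
    using assms(5,6) by (auto simp: ys_def last_take_drop hd_drop_conv_nth)
  moreover have "successively (\<lambda>u v. (u, v) \<in> parcs G) ys"
    unfolding ys_def by (intro successively_take successively_drop assms)
  moreover have "distinct ys"
    using assms(2) by (simp add: ys_def)
  moreover have "3 \<le> j - i + 1"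
    using assms(5) by arith
  ultimately have "girth G \<le> j - i + 1"
    using girth_le_length[OF assms(1), of ys] chord by simp
  with assms show False
    by simp
qed

text \<open>Going through \<open>w\<close> closes the segment to a cycle on \<open>j - i + 2\<close>
  vertices, which explains the bound on \<open>j - i\<close>. The gap of 3 serves the case that
  \<open>w\<close> lies on the segment.\<close>

lemma girth_path_not_in_same_nbhd:
  assumes "pair_graph G" "distinct xs" "length xs = girth G"
    and path: "successively (\<lambda>u v. (u, v) \<in> parcs G) xs"
    and ij: "i + 3 \<le> j" "j < length xs" "j - i + 2 < length xs"
    and nbhd: "xs ! i \<in> closed_nbhd G w" "xs ! j \<in> closed_nbhd G w"
  shows False
proof -
  interpret pair_graph G by fact
  note chord = girth_path_no_chord[OF assms(1-4)]
  have no_edge: "(xs ! i, xs ! j) \<notin> parcs G" "(xs ! j, xs ! i) \<notin> parcs G"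
    using chord[of i j] ij arcs_symmetric by auto
  have "xs ! i \<noteq> xs ! j"
    using assms(2) ij by (simp add: nth_eq_iff_index_eq)
  \<comment> \<open>If \<open>w\<close> were one of the two vertices, the other would be adjacent to
    it, contrary to \<open>no_edge\<close>.\<close>
  with nbhd no_edge have w: "(w, xs ! i) \<in> parcs G" "(w, xs ! j) \<in> parcs G"
    by (auto simp: closed_nbhd_def)
  define ys where "ys = take (Suc (j - i)) (drop i xs)"
  have ys: "hd ys = xs ! i" "last ys = xs ! j" "length ys = j - i + 1" "ys \<noteq> []"
    using ij by (auto simp: ys_def last_take_drop hd_drop_conv_nth)
  show False
  proof (cases "w \<in> set ys")
    case True
    then obtain m where m: "m < length ys" "ys ! m = w"
      by (auto simp: in_set_conv_nth)
    define k where "k = i + m"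
    have k: "i \<le> k" "k \<le> j" "w = xs ! k"
      using m ij ys(3) by (auto simp: k_def ys_def)
    show False
    proof (cases "i + 2 \<le> k")
      case True
      then show False
        using chord[of i k] k ij w by auto
    next
      case False
      \<comment> \<open>As \<open>i\<close> and \<open>j\<close> are at least 3 apart,
        \<open>w\<close> is at least two steps away from one of them, and its edge to that one is a
        chord.\<close>
      then have "k + 2 \<le> j" "j - k + 1 < length xs"
        using k ij by linarith+
      then show False
        using chord[of k j] k ij w arcs_symmetric by auto
    qed
  next
    case False
    have "successively (\<lambda>u v. (u, v) \<in> parcs G) ys"
      unfolding ys_def by (intro successively_take successively_drop path)
    then have "girth G \<le> length (w # ys)"
      using False ys w ij assms(2) arcs_symmetric
      by (intro girth_le_length[OF assms(1)]) (auto simp: successively_Cons ys_def)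
    with ys ij assms(3) show False
      by simp
  qed
qed

section \<open>The packing of every third vertex\<close>

lemma finite_limited_packings:
  assumes "finite (pverts G)"
  shows "finite {card B | B. limited_packing k G B}"
proof -
  have "{card B | B. limited_packing k G B} \<subseteq> card ` Pow (pverts G)"
    by (auto simp: limited_packing_def)
  then show ?thesis
    using assms by (meson finite_Pow_iff finite_imageI finite_subset)
qed

lemma girth_div_3_le_packing_number:
  assumes "pair_graph G" "\<exists>p. graph_cycle G p"
  shows "girth G div 3 \<le> limited_packing_number 1 G"
proof -
  interpret pair_graph G by fact
  obtain xs where xs: "distinct xs" "length xs = girth G" "set xs \<subseteq> pverts G"
    "successively (\<lambda>u v. (u, v) \<in> parcs G) xs"
    using assms by (rule girth_path)
  define B where "B = (\<lambda>a. xs ! (3 * a)) ` {..<girth G div 3}"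
  have no_common: False
    if "a < b" "b < girth G div 3" "xs ! (3 * a) \<in> closed_nbhd G w" "xs ! (3 * b) \<in> closed_nbhd G w"
    for a b w
  proof (rule girth_path_not_in_same_nbhd[OF assms(1) xs(1,2,4) _ _ _ that(3,4)])
    \<comment> \<open>The largest chosen index is at most the girth minus 3, so
      \<open>3 * b - 3 * a + 2\<close> stays below the girth. This is where rounding down matters:
      the gap across the cut of the cycle is at least 3 too.\<close>
    show "3 * a + 3 \<le> 3 * b" "3 * b < length xs" "3 * b - 3 * a + 2 < length xs"
      using that(1,2) xs(2) by linarith+
  qed
  have "card (closed_nbhd G w \<inter> B) \<le> 1" for w
  proof -
    have "x = y" if "x \<in> closed_nbhd G w \<inter> B" "y \<in> closed_nbhd G w \<inter> B" for x y
    proof -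
      from that obtain a b
        where "a < girth G div 3" "x = xs ! (3 * a)" "b < girth G div 3" "y = xs ! (3 * b)"
        by (auto simp: B_def)
      with that no_common[of a b w] no_common[of b a w] show ?thesis
        by (cases a b rule: linorder_cases) auto
    qed
    moreover have "finite (closed_nbhd G w \<inter> B)"
      by (simp add: B_def)
    ultimately show ?thesis
      by (simp add: card_le_Suc0_iff_eq)
  qed
  moreover have "B \<subseteq> pverts G"
    using xs by (auto simp: B_def)
  ultimately have "limited_packing 1 G B"
    by (simp add: limited_packing_def)
  moreover have "card B = girth G div 3"
    unfolding B_def using xs(1,2) by (subst card_image) (auto simp: inj_on_def nth_eq_iff_index_eq)
  ultimately show ?thesis
    unfolding limited_packing_number_def
    by (intro Max_ge finite_limited_packings pair_finite_verts) (auto intro: exI[of _ B])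
qed

section \<open>Tightness for the triangle\<close>

definition triangle :: "nat pair_pre_digraph" where
  "triangle = \<lparr>pverts = {0, 1, 2}, parcs = {(0, 1), (1, 0), (1, 2), (2, 1), (0, 2), (2, 0)}\<rparr>"

lemma pair_graph_triangle: "pair_graph triangle"
  by unfold_locales (auto simp: triangle_def symmetric_def sym_def)

lemma graph_cycle_triangle: "graph_cycle triangle [(0, 1), (1, 2), (2, 0)]"
  using graph_cycle_vwalk_arcs[OF pair_graph_triangle, of "[0, 1, 2]"] by (simp add: triangle_def)

lemma girth_triangle: "girth triangle = 3"
proof (rule antisym)
  show "girth triangle \<le> 3"
    using girth_le_length[OF pair_graph_triangle, of "[0, 1, 2]"] by (simp add: triangle_def)
  obtain p where "graph_cycle triangle p" "length p = girth triangle"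
    using girth_attained graph_cycle_triangle by blast
  \<comment> \<open>The bound is the length condition in \<open>graph_cycle\<close>.\<close>
  then show "3 \<le> girth triangle"
    by (simp add: graph_cycle_def)
qed

text \<open>Vertex 0 is adjacent to both others, so its closed neighbourhood contains any packing
  entirely.\<close>

lemma packing_number_triangle_le: "limited_packing_number 1 triangle \<le> 1"
proof -
  have le: "card B \<le> 1" if "limited_packing 1 triangle B" for B
  proof -
    have "B \<subseteq> {0, 1, 2}" "card (closed_nbhd triangle 0 \<inter> B) \<le> 1"
      using that by (auto simp: limited_packing_def triangle_def)
    moreover have "closed_nbhd triangle 0 = {0, 1, 2}"
      by (auto simp: closed_nbhd_def triangle_def)
    ultimately show ?thesis
      by (simp add: Int_absorb1)
  qed
  \<comment> \<open>The empty packing shows that the maximum is over a nonempty set.\<close>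
  have "limited_packing 1 triangle {}"
    by (simp add: limited_packing_def)
  then show ?thesis
    unfolding limited_packing_number_def using le
    by (intro Max.boundedI finite_limited_packings) (auto simp: triangle_def)
qed

theorem theorem3p7:
  shows "(\<forall>G :: 'a pair_pre_digraph.
            nontrivial_graph G \<and> (\<exists>p. graph_cycle G p)
              \<longrightarrow> girth G div 3 \<le> limited_packing_number 1 G)
       \<and> (\<exists>H :: nat pair_pre_digraph.
            nontrivial_graph H \<and> (\<exists>p. graph_cycle H p)
              \<and> limited_packing_number 1 H = girth H div 3)"
proof (intro conjI allI impI exI[of _ triangle])
  fix G :: "'a pair_pre_digraph"
  assume "nontrivial_graph G \<and> (\<exists>p. graph_cycle G p)"
  then show "girth G div 3 \<le> limited_packing_number 1 G"
    using girth_div_3_le_packing_number by (auto simp: nontrivial_graph_def)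
next
  show "nontrivial_graph triangle"
    using pair_graph_triangle by (simp add: nontrivial_graph_def triangle_def)
  show cycle: "\<exists>p. graph_cycle triangle p"
    using graph_cycle_triangle by blast
  \<comment> \<open>The reverse inequality is the general bound at girth 3.\<close>
  show "limited_packing_number 1 triangle = girth triangle div 3"
    using packing_number_triangle_le girth_div_3_le_packing_number[OF pair_graph_triangle cycle]
    by (simp add: girth_triangle)
qed

end
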